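(* Let $N\ge1$, $T\ge1$, $0\le S\le T-1$ be integers and let $X\in\Omega(N,T,S)$. Let $Y=(Y(0),\dots,Y(T))$ be the random sequence produced from $X$ by the $S\mapsto S+1$ algorithm described in the context. Then $Y\in\Omega(N,T,S+1)$ almost surely and its law is the row of the matrix $P^S_{S\mapsto S+1}$ (defined in the context) indexed by $X$: for every $Y'\in\Omega(N,T,S+1)$, $$\mathrm{Prob}\{Y=Y'\}=P^S_{S\mapsto S+1}(X,Y').$$
   Context: Fix integers $N\ge1$, $T\ge1$. For an integer $0\le S\le T$, $\Omega(N,T,S)$ is the set of families of $N$ non-intersecting lattice paths $\tau_1,\dots,\tau_N:\{0,1,\dots,T\}\to\mathbb Z$ with $\tau_i(0)=i-1$, $\tau_i(T)=S+i-1$, $\tau_i(t+1)-\tau_i(t)\in\{0,1\}$ and $\tau_1(t)<\dots<\tau_N(t)$ for all $t$. Such a family is identified with the sequence $X=(X(0),X(1),\dots,X(T))$, $X(t)=(\tau_1(t),\dots,\tau_N(t))$. For $0\le S,t\le T$ put $$\mathfrak X^{S,t}=\{x\in\mathbb Z:\max(0,t+S-T)\le x\le\min(t+N-1,S+N-1)\},$$ $$\mathcal X^{S,t}=\{(x_1,\dots,x_N)\in(\mathfrak X^{S,t})^N: x_1<\dots<x_N\}.$$ $(a)_k=a(a+1)\cdots(a+k-1)$. Matrix $P^{S,t}_{t+}$ ($0\le t\le T-1$), of size $|\mathcal X^{S,t}|\times|\mathcal X^{S,t+1}|$: $$P^{S,t}_{t+}(X,Y)=\frac{\prod_{i<j}(y_j-y_i)\prod_{i:y_i=x_i+1}(N+S-x_i-1)\prod_{i:y_i=x_i}(x_i+T-t-S)}{(T-t)_N\prod_{i<j}(x_j-x_i)}$$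 if $y_i-x_i\in\{0,1\}$ for all $i$, and $0$ otherwise. Matrix $P^{S,t}_{S-}$ ($1\le S\le T$), of size $|\mathcal X^{S,t}|\times|\mathcal X^{S-1,t}|$: $$P^{S,t}_{S-}(X,Y)=\frac{\prod_{i<j}(y_j-y_i)\prod_{i:y_i=x_i-1}x_i\prod_{i:y_i=x_i}(S+N-1-x_i)}{(S)_N\prod_{i<j}(x_j-x_i)}$$ if $y_i-x_i\in\{-1,0\}$ for all $i$, and $0$ otherwise. For $0\le S\le T-1$, $X\in\Omega(N,T,S)$, $Y\in\Omega(N,T,S+1)$ define $$P^S_{S\mapsto S+1}(X,Y)=\prod_{t=0}^{T-1}\frac{P^{S+1,t}_{t+}(Y(t),Y(t+1))\,P^{S+1,t+1}_{S-}(Y(t+1),X(t+1))}{(P^{S+1,t}_{t+}P^{S+1,t+1}_{S-})(Y(t),X(t+1))}$$ if $\prod_{t=0}^{T-1}(P^{S+1,t}_{t+}P^{S+1,t+1}_{S-})(Y(t),X(t+1))>0$, and $0$ otherwise. Distribution $D(a,b,n)$: the probability distribution on $\{0,1,\dots,n\}$ with $$D(a,b,n)\{k\}=\frac{a(a+1)\cdots(a+k-1)\,(b+k)\cdots(b+n-1)}{\sum_{j=0}^n a(a+1)\cdots(a+j-1)\,(b+j)\cdots(b+n-1)}.$$ Algorithm ($S\mapsto S+1$). Input $X=(X(0),\dots,X(T))\in\Omega(N,T,S)$. Set $Y(0)=(0,1,\dots,N-1)$. For $t=0,1,\dots,T-1$ successively, construct $Y(t+1)=(z_1<\dots<z_N)$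 from $Y(t)=(y_1<\dots<y_N)$ and $X(t+1)=(x_1<\dots<x_N)$ as follows (it always holds that $x_i-y_i\in\{-1,0,1\}$): (1) for all $i$ with $x_i-y_i=1$ set $z_i=x_i$; (2) for all $i$ with $x_i-y_i=-1$ set $z_i=y_i$; (3) take all $i$ with $x_i=y_i$ and split the set of the corresponding integers $x_i$ into maximal blocks of consecutive integers. A block $\{k,k+1,\dots,k+l-1\}$, with smallest element $k$ and size $l$, is called a $(k,l)$-block. For each $(k,l)$-block take a random variable $\xi$ with distribution $D(k+T-t-S-1,\,k+1,\,l)$; the variables $\xi$ for different blocks (and different $t$) are sampled independently. Set $z_i=x_i$ for the $\xi$ smallest elements $x_i$ of the block, and $z_i=x_i+1$ for the remaining elements of the block. *)

theory Defs
  imports "HOL-Probability.Probability"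
begin

text \<open>
  A point configuration \<open>x\<^sub>1 < \<dots> < x\<^sub>N\<close> is a list of integers of length \<open>N\<close>, so that
  \<open>x\<^sub>i\<close> is \<open>x ! (i - 1)\<close>; a path family is the list \<open>[X(0), \<dots>, X(T)]\<close> of its
  \<open>T + 1\<close> configurations. All particle indices below run over \<open>0, \<dots>, N - 1\<close>.
\<close>

definition path_families :: "nat \<Rightarrow> nat \<Rightarrow> nat \<Rightarrow> int list list set" where
  "path_families N T S = {X. length X = T + 1 \<and>
     (\<forall>t\<le>T. length (X ! t) = N) \<and>
     (\<forall>i<N. X ! 0 ! i = int i) \<and>
     (\<forall>i<N. X ! T ! i = int S + int i) \<and>
     (\<forall>t<T. \<forall>i<N. X ! (t + 1) ! i - X ! t ! i \<in> {0, 1}) \<and>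
     (\<forall>t\<le>T. sorted_wrt (<) (X ! t))}"

definition slice :: "nat \<Rightarrow> nat \<Rightarrow> nat \<Rightarrow> nat \<Rightarrow> int set" where
  "slice N T S t = {x. max 0 (int t + int S - int T) \<le> x \<and>
     x \<le> min (int t + int N - 1) (int S + int N - 1)}"

definition configs :: "nat \<Rightarrow> nat \<Rightarrow> nat \<Rightarrow> nat \<Rightarrow> int list set" where
  "configs N T S t = {x. length x = N \<and> set x \<subseteq> slice N T S t \<and> sorted_wrt (<) x}"

definition vandermonde :: "nat \<Rightarrow> int list \<Rightarrow> real" where
  "vandermonde N x = (\<Prod>(i, j)\<in>{(i, j). i < j \<and> j < N}. real_of_int (x ! j - x ! i))"

text \<open>
  A matrix with rows and columns indexed by sets of configurations is a function of two
  configurations; only its values on the index sets are relevant. For \<open>P_tplus N T S t\<close>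
  these are \<open>configs N T S t\<close> and \<open>configs N T S (t + 1)\<close>; for \<open>P_Sminus N T S t\<close>
  they are \<open>configs N T S t\<close> and \<open>configs N T (S - 1) t\<close>. The entries of the latter
  do not depend on \<open>T\<close> and \<open>t\<close>.
\<close>

definition P_tplus :: "nat \<Rightarrow> nat \<Rightarrow> nat \<Rightarrow> nat \<Rightarrow> int list \<Rightarrow> int list \<Rightarrow> real" where
  "P_tplus N T S t x y =
     (if \<forall>i<N. y ! i - x ! i \<in> {0, 1} then
        vandermonde N y
        * (\<Prod>i\<in>{i. i < N \<and> y ! i = x ! i + 1}. real_of_int (int N + int S - x ! i - 1))
        * (\<Prod>i\<in>{i. i < N \<and> y ! i = x ! i}. real_of_int (x ! i + int T - int t - int S))
        / (pochhammer (real T - real t) N * vandermonde N x)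
      else 0)"

definition P_Sminus :: "nat \<Rightarrow> nat \<Rightarrow> nat \<Rightarrow> nat \<Rightarrow> int list \<Rightarrow> int list \<Rightarrow> real" where
  "P_Sminus N T S t x y =
     (if \<forall>i<N. y ! i - x ! i \<in> {-1, 0} then
        vandermonde N y
        * (\<Prod>i\<in>{i. i < N \<and> y ! i = x ! i - 1}. real_of_int (x ! i))
        * (\<Prod>i\<in>{i. i < N \<and> y ! i = x ! i}. real_of_int (int S + int N - 1 - x ! i))
        / (pochhammer (real S) N * vandermonde N x)
      else 0)"

text \<open>The matrix product of \<open>P_tplus N T S t\<close> and \<open>P_Sminus N T S (t + 1)\<close>.\<close>

definition P_tplus_Sminus :: "nat \<Rightarrow> nat \<Rightarrow> nat \<Rightarrow> nat \<Rightarrow> int list \<Rightarrow> int list \<Rightarrow> real" where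
  "P_tplus_Sminus N T S t y x =
     (\<Sum>z\<in>configs N T S (t + 1). P_tplus N T S t y z * P_Sminus N T S (t + 1) z x)"

definition P_S_up :: "nat \<Rightarrow> nat \<Rightarrow> nat \<Rightarrow> int list list \<Rightarrow> int list list \<Rightarrow> real" where
  "P_S_up N T S X Y =
     (if (\<Prod>t<T. P_tplus_Sminus N T (S + 1) t (Y ! t) (X ! (t + 1))) > 0 then
        (\<Prod>t<T. P_tplus N T (S + 1) t (Y ! t) (Y ! (t + 1))
                * P_Sminus N T (S + 1) (t + 1) (Y ! (t + 1)) (X ! (t + 1))
                / P_tplus_Sminus N T (S + 1) t (Y ! t) (X ! (t + 1)))
      else 0)"

definition D_weight :: "real \<Rightarrow> real \<Rightarrow> nat \<Rightarrow> nat \<Rightarrow> real" where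
  "D_weight a b n k = pochhammer a k * pochhammer (b + real k) (n - k)"

text \<open>
  The parameters are meant to satisfy \<open>a \<ge> 0\<close> and \<open>b > 0\<close>; lemma \<open>pmf_D_dist\<close>
  then gives the point masses.
\<close>

definition D_dist :: "real \<Rightarrow> real \<Rightarrow> nat \<Rightarrow> nat pmf" where
  "D_dist a b n = embed_pmf (\<lambda>k. if k \<le> n
     then D_weight a b n k / (\<Sum>j=0..n. D_weight a b n j) else 0)"

lemma pochhammer_nonneg_real: "pochhammer a k \<ge> 0" if "a \<ge> 0" for a :: real
  using that by (auto simp: pochhammer_prod intro!: prod_nonneg)

lemma D_weight_nonneg:
  assumes "a \<ge> 0" "b > 0"
  shows "D_weight a b n k \<ge> 0"
  using assms by (auto simp: D_weight_def intro!: mult_nonneg_nonneg pochhammer_nonneg_real)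

lemma D_weight_sum_pos:
  assumes "a \<ge> 0" "b > 0"
  shows "(\<Sum>j=0..n. D_weight a b n j) > 0"
proof -
  have "D_weight a b n 0 > 0"
    using assms by (simp add: D_weight_def pochhammer_pos)
  then show ?thesis
    by (intro sum_pos2[where i = 0]) (auto simp: D_weight_nonneg[OF assms])
qed

lemma pmf_D_dist:
  assumes "a \<ge> 0" "b > 0"
  shows "pmf (D_dist a b n) k =
    (if k \<le> n then D_weight a b n k / (\<Sum>j=0..n. D_weight a b n j) else 0)"
  unfolding D_dist_def
proof (rule pmf_embed_pmf)
  let ?s = "\<Sum>j=0..n. D_weight a b n j"
  let ?f = "\<lambda>k. if k \<le> n then D_weight a b n k / ?s else 0"
  note nn = D_weight_nonneg[OF assms] and pos = D_weight_sum_pos[OF assms, of n]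
  show f: "?f k \<ge> 0" for k
    using nn[of n k] pos by (simp add: divide_nonneg_pos)
  have "(\<integral>\<^sup>+k. ennreal (?f k) \<partial>count_space UNIV) = (\<Sum>k\<in>{0..n}. ennreal (?f k))"
    by (intro nn_integral_count_space') auto
  also have "\<dots> = ennreal (\<Sum>k\<in>{0..n}. ?f k)"
    by (rule sum_ennreal) (rule f)
  also have "(\<Sum>k\<in>{0..n}. ?f k) = (\<Sum>k\<in>{0..n}. D_weight a b n k / ?s)"
    by (intro sum.cong) auto
  also have "\<dots> = 1"
    using pos by (simp add: sum_divide_distrib [symmetric])
  finally show "(\<integral>\<^sup>+k. ennreal (?f k) \<partial>count_space UNIV) = 1" by simp
qed

text \<open>The pairs \<open>(k, l)\<close> such that \<open>{k, \<dots>, k + l - 1}\<close> is a maximal block of \<open>A\<close>.\<close>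

definition blocks :: "int set \<Rightarrow> (int \<times> nat) set" where
  "blocks A = {(k, l). l \<ge> 1 \<and> {k..<k + int l} \<subseteq> A \<and> k - 1 \<notin> A \<and> k + int l \<notin> A}"

lemma finite_blocks:
  assumes "finite A"
  shows "finite (blocks A)"
proof (rule finite_subset)
  show "blocks A \<subseteq> A \<times> {..card A}"
  proof (clarsimp simp: blocks_def)
    fix k :: int and l :: nat
    assume l: "Suc 0 \<le> l" and sub: "{k..<k + int l} \<subseteq> A"
    have "k \<in> {k..<k + int l}" using l by simp
    moreover have "card {k..<k + int l} \<le> card A"
      using assms sub by (rule card_mono)
    ultimately show "k \<in> A \<and> l \<le> card A" using sub by auto
  qed
  show "finite (A \<times> {..card A})" using assms by simp
qed

definition stay_points :: "nat \<Rightarrow> int list \<Rightarrow> int list \<Rightarrow> int set" where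
  "stay_points N y x = {x ! i | i. i < N \<and> x ! i = y ! i}"

text \<open>
  The next configuration \<open>z\<close>, given \<open>y = Y(t)\<close>, \<open>x = X(t + 1)\<close> and the sampled value
  \<open>\<xi> (k, l)\<close> of each \<open>(k, l)\<close>-block: the \<open>\<xi> (k, l)\<close> smallest elements of that
  block are those less than \<open>k + \<xi> (k, l)\<close>. The last case does not occur when \<open>x\<close>
  comes from a path family and \<open>y\<close> from the algorithm.
\<close>

definition update_config ::
    "nat \<Rightarrow> int list \<Rightarrow> int list \<Rightarrow> (int \<times> nat \<Rightarrow> nat) \<Rightarrow> int list" where
  "update_config N y x \<xi> = map (\<lambda>i.
     if x ! i - y ! i = 1 then x ! i
     else if x ! i - y ! i = -1 then y ! i
     else if x ! i = y ! i then
       (if \<exists>(k, l)\<in>blocks (stay_points N y x).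
             x ! i \<in> {k..<k + int l} \<and> x ! i < k + int (\<xi> (k, l))
        then x ! i else x ! i + 1)
     else undefined) [0..<N]"

definition algorithm_step ::
    "nat \<Rightarrow> nat \<Rightarrow> nat \<Rightarrow> nat \<Rightarrow> int list \<Rightarrow> int list \<Rightarrow> int list pmf" where
  "algorithm_step N T S t y x =
     map_pmf (update_config N y x)
       (Pi_pmf (blocks (stay_points N y x)) 0
         (\<lambda>(k, l). D_dist (real_of_int (k + int T - int t - int S - 1))
                          (real_of_int (k + 1)) l))"

text \<open>
  The joint law of \<open>[Y(0), \<dots>, Y(t)]\<close>. Fresh variables are drawn at each time, independently
  of the past, which is the monadic bind.
\<close>

primrec algorithm_upto ::
    "nat \<Rightarrow> nat \<Rightarrow> nat \<Rightarrow> int list list \<Rightarrow> nat \<Rightarrow> int list list pmf" where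
  "algorithm_upto N T S X 0 = return_pmf [map int [0..<N]]"
| "algorithm_upto N T S X (Suc t) =
     bind_pmf (algorithm_upto N T S X t) (\<lambda>Y.
       map_pmf (\<lambda>z. Y @ [z]) (algorithm_step N T S t (Y ! t) (X ! (t + 1))))"

definition algorithm_S_up :: "nat \<Rightarrow> nat \<Rightarrow> nat \<Rightarrow> int list list \<Rightarrow> int list list pmf" where
  "algorithm_S_up N T S X = algorithm_upto N T S X T"

end

theory Submission
  imports Defs
begin

text \<open>
  Given \<open>y = Y(t)\<close> and \<open>x = X(t + 1)\<close>, the Vandermonde factors of \<open>z\<close> cancel in
  \<open>P_tplus y z * P_Sminus z x\<close>, which leaves a product over the particles. Those with \<open>x\<^sub>i \<noteq> y\<^sub>i\<close>
  have a forced move and contribute a positive constant. One with \<open>x\<^sub>i = y\<^sub>i\<close> contributes, up to a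
  constant, \<open>x\<^sub>i + T - t - S - 1\<close> if it stays and \<open>x\<^sub>i + 1\<close> if it moves. The ordering of \<open>z\<close> only
  says that inside a maximal block the staying particles are the lowest ones, and then the product
  over a block is the weight of \<open>D\<close>. So the law of one step is proportional to the summands of
  the matrix product; multiplying over \<open>t\<close> gives the theorem. Both sides vanish on those \<open>Y'\<close>
  for which some \<open>X(t + 1) - Y'(t)\<close> has an entry outside \<open>{-1, 0, 1}\<close>.
\<close>

section \<open>Maximal blocks\<close>

text \<open>Extend from \<open>a\<close> to both sides as far as \<open>A\<close> permits;
  finiteness of \<open>A\<close> makes both extents attained.\<close>

lemma blocks_cover:
  assumes "finite A" "a \<in> A"
  shows "\<exists>k l. (k, l) \<in> blocks A \<and> a \<in> {k..<k + int l}"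
proof -
  define L where "L = {m. m \<le> a \<and> {m..a} \<subseteq> A}"
  define U where "U = {m. a \<le> m \<and> {a..m} \<subseteq> A}"
  have fin: "finite L" "finite U"
    by (rule finite_subset[OF _ assms(1)]; force simp: L_def U_def)+
  have ne: "a \<in> L" "a \<in> U"
    using assms(2) by (auto simp: L_def U_def)
  define k u where "k = Min L" and "u = Max U"
  have k: "k \<in> L" and u: "u \<in> U"
    using fin ne by (auto simp: k_def u_def intro!: Min_in Max_in)
  have "k - 1 \<notin> L"
    using fin(1) Min_le[of L "k - 1"] by (auto simp: k_def)
  moreover have "{k - 1..a} = insert (k - 1) {k..a}"
    using k by (auto simp: L_def)
  ultimately have k': "k - 1 \<notin> A"
    using k by (auto simp: L_def)
  have "u + 1 \<notin> U"
    using fin(2) Max_ge[of U "u + 1"] by (auto simp: u_def)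
  moreover have "{a..u + 1} = insert (u + 1) {a..u}"
    using u by (auto simp: U_def)
  ultimately have u': "u + 1 \<notin> A"
    using u by (auto simp: U_def)
  define l where "l = nat (u + 1 - k)"
  have l: "k + int l = u + 1" "l \<ge> 1"
    using k u by (auto simp: l_def L_def U_def)
  have "{k..<k + int l} \<subseteq> {k..a} \<union> {a..u}"
    using l by auto
  then have "{k..<k + int l} \<subseteq> A"
    using k u by (auto simp: L_def U_def)
  then have "(k, l) \<in> blocks A"
    using l k' u' by (auto simp: blocks_def)
  moreover have "a \<in> {k..<k + int l}"
    using l k u by (auto simp: L_def U_def)
  ultimately show ?thesis by blast
qed

text \<open>If the second block overran an end of the first, the point just beyond that end would
  lie in \<open>A\<close>, against maximality. Used in both directions, this makes overlapping
  blocks coincide.\<close>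

lemma blocks_le_start:
  assumes "(k, l) \<in> blocks A" "(k', l') \<in> blocks A"
    and "a \<in> {k..<k + int l}" "a \<in> {k'..<k' + int l'}"
  shows "k \<le> k'" "k' + int l' \<le> k + int l"
proof -
  have A: "{k'..<k' + int l'} \<subseteq> A" "k - 1 \<notin> A" "k + int l \<notin> A"
    using assms by (auto simp: blocks_def)
  show "k \<le> k'"
  proof (rule ccontr)
    assume "\<not> k \<le> k'"
    then have "k - 1 \<in> {k'..<k' + int l'}" using assms by auto
    then show False using A by blast
  qed
  show "k' + int l' \<le> k + int l"
  proof (rule ccontr)
    assume "\<not> ?thesis"
    then have "k + int l \<in> {k'..<k' + int l'}" using assms by auto
    then show False using A by blast
  qed
qed

lemma blocks_unique:
  assumes "(k, l) \<in> blocks A" "(k', l') \<in> blocks A"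
    and "a \<in> {k..<k + int l}" "a \<in> {k'..<k' + int l'}"
  shows "k = k' \<and> l = l'"
  using blocks_le_start[OF assms] blocks_le_start[OF assms(2,1,4,3)] by auto

text \<open>The blocks partition \<open>A\<close>. The inner index is the offset from the left end,
  the form in which \<open>prod_threshold\<close> recognizes a weight of D.\<close>

lemma prod_blocks:
  fixes f :: "int \<Rightarrow> 'a::comm_monoid_mult"
  assumes "finite A"
  shows "prod f A = (\<Prod>(k, l)\<in>blocks A. \<Prod>j<l. f (k + int j))"
proof -
  have "A = (\<Union>(k, l)\<in>blocks A. {k..<k + int l})"
    using blocks_cover[OF assms] by (fastforce simp: blocks_def)
  then have "prod f A = prod f (\<Union>p\<in>blocks A. case p of (k, l) \<Rightarrow> {k..<k + int l})"
    by simp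
  also have "\<dots> = (\<Prod>p\<in>blocks A. prod f (case p of (k, l) \<Rightarrow> {k..<k + int l}))"
    using finite_blocks[OF assms]
    by (rule prod.UNION_disjoint) (use blocks_unique in fastforce)+
  also have "\<dots> = (\<Prod>(k, l)\<in>blocks A. \<Prod>j<l. f (k + int j))"
  proof (intro prod.cong refl, clarify)
    fix k :: int and l :: nat
    show "prod f {k..<k + int l} = (\<Prod>j<l. f (k + int j))"
      by (rule prod.reindex_bij_witness[of _ "\<lambda>j. k + int j" "\<lambda>i. nat (i - k)"]) auto
  qed
  finally show ?thesis .
qed

section \<open>Threshold products and the distribution D\<close>

lemma prod_threshold:
  assumes "n \<le> l"
  shows "(\<Prod>j<l. if j < n then a + real j else b + real j) = D_weight a b l n"
proof -
  have "(\<Prod>j<l. if j < n then a + real j else b + real j) =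
      (\<Prod>j<n. a + real j) * (\<Prod>j=n..<l. b + real j)"
  proof -
    have "{..<l} = {..<n} \<union> {n..<l}" using assms by auto
    then show ?thesis by (simp add: prod.union_disjoint ivl_disj_int)
  qed
  also have "(\<Prod>j=n..<l. b + real j) = (\<Prod>j<l - n. b + real n + real j)"
    by (rule prod.reindex_bij_witness[of _ "\<lambda>j. j + n" "\<lambda>j. j - n"]) auto
  finally show ?thesis
    by (simp add: D_weight_def pochhammer_prod atLeast0LessThan)
qed

lemma set_pmf_D_dist:
  assumes "a \<ge> 0" "b > 0"
  shows "set_pmf (D_dist a b n) \<subseteq> {..n}"
  by (auto simp: set_pmf_iff pmf_D_dist[OF assms] split: if_splits)

text \<open>With first parameter 0 every weight of positive index contains the factor 0. This pushes
  a particle off the lowest admissible point.\<close>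

lemma set_pmf_D_dist_0:
  assumes "b > 0"
  shows "set_pmf (D_dist 0 b n) \<subseteq> {0}"
  using assms by (auto simp: set_pmf_iff pmf_D_dist D_weight_def pochhammer_0_left split: if_splits)

text \<open>Serves to merge the products over moving and over resting particles in a matrix entry
  into one product over all particles.\<close>

lemma prod_complementary_filters:
  fixes f g :: "nat \<Rightarrow> 'a::comm_monoid_mult"
  assumes "\<And>i. i < N \<Longrightarrow> Q i \<longleftrightarrow> \<not> P i"
  shows "(\<Prod>i\<in>{i. i < N \<and> P i}. f i) * (\<Prod>i\<in>{i. i < N \<and> Q i}. g i) =
    (\<Prod>i<N. if P i then f i else g i)"
proof -
  have "{i. i < N \<and> P i} = {..<N} \<inter> {i. P i}" "{i. i < N \<and> Q i} = {..<N} \<inter> - {i. P i}"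
    using assms by auto
  then show ?thesis
    by (simp only: prod.If_cases[OF finite_lessThan])
qed

text \<open>Induction on \<open>l\<close>: if the top position satisfies \<open>Q\<close>, all
  positions do; otherwise the threshold of the shorter interval still works. This encodes the
  pattern of stays in a block by one number.\<close>

lemma threshold_of_downclosed:
  fixes Q :: "int \<Rightarrow> bool"
  assumes "\<And>j. j + 1 < l \<Longrightarrow> Q (k + int j + 1) \<Longrightarrow> Q (k + int j)"
  shows "\<exists>n\<le>l. \<forall>j<l. Q (k + int j) \<longleftrightarrow> j < n"
  using assms
proof (induction l)
  case (Suc l)
  then obtain n where n: "n \<le> l" "\<forall>j<l. Q (k + int j) \<longleftrightarrow> j < n"
    by fastforce
  show ?case
  proof (cases "Q (k + int l)")
    case True
    have "Q (k + int j)" if "j \<le> l" for j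
      using that
    proof (induction j rule: inc_induct)
      case (step j)
      then show ?case using Suc.prems[of j] by (simp add: ac_simps)
    qed (fact True)
    then show ?thesis by (intro exI[of _ "Suc l"]) auto
  next
    case False
    then show ?thesis using n by (intro exI[of _ n]) (auto simp: less_Suc_eq)
  qed
qed auto

lemma vandermonde_pos:
  assumes "sorted_wrt (<) x" "length x = N"
  shows "vandermonde N x > 0"
  unfolding vandermonde_def using assms
  by (auto intro!: prod_pos simp: sorted_wrt_iff_nth_less)

lemma finite_configs: "finite (configs N T S t)"
proof (rule finite_subset)
  show "configs N T S t \<subseteq> {z. set z \<subseteq> slice N T S t \<and> length z = N}"
    by (auto simp: configs_def)
  have "slice N T S t \<subseteq> {0..int t + int N}" by (auto simp: slice_def)
  then show "finite {z. set z \<subseteq> slice N T S t \<and> length z = N}"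
    by (intro finite_lists_length_eq) (rule finite_subset, auto)
qed

lemma P_tplus_mult_P_Sminus_eq_0:
  assumes "i < N" "z ! i - y ! i \<notin> {0, 1} \<or> x ! i - z ! i \<notin> {-1, 0}"
  shows "P_tplus N T S t y z * P_Sminus N T S (t + 1) z x = 0"
proof -
  have "\<not> (\<forall>i<N. z ! i - y ! i \<in> {0, 1}) \<or> \<not> (\<forall>i<N. x ! i - z ! i \<in> {-1, 0})"
    using assms by blast
  then show ?thesis
    by (elim disjE) (simp_all only: P_tplus_def P_Sminus_def if_False mult_zero_left mult_zero_right)
qed

section \<open>One step of the algorithm\<close>

text \<open>Here \<open>y\<close> is Y(t) at level \<open>S + 1\<close> and \<open>x\<close> is X(t
  + 1) at level \<open>S\<close>. Nothing refers to the past of the run, so the locale applies to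
  the algorithm and also to a given target family.\<close>

locale update_step =
  fixes N T S t :: nat and y x :: "int list"
  assumes S: "S < T" and t: "t < T"
    and y: "y \<in> configs N T (S + 1) t" and x: "x \<in> configs N T S (t + 1)"
    and diff: "\<And>i. i < N \<Longrightarrow> x ! i - y ! i \<in> {-1, 0, 1}"
begin

abbreviation "A \<equiv> stay_points N y x"

definition stays :: "(int \<times> nat \<Rightarrow> nat) \<Rightarrow> int \<Rightarrow> bool" where
  "stays \<xi> a \<longleftrightarrow> (\<exists>(k, l)\<in>blocks A. a \<in> {k..<k + int l} \<and> a < k + int (\<xi> (k, l)))"

text \<open>Describes the possible outcomes without the random variables. Membership in the slice is
  left out because it depends on the support of D and not only on the update rule.\<close>

definition interlaced :: "int list \<Rightarrow> bool" where
  "interlaced z \<longleftrightarrow> length z = N \<and> sorted_wrt (<) z \<and>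
     (\<forall>i<N. z ! i - y ! i \<in> {0, 1} \<and> z ! i - x ! i \<in> {0, 1})"

definition stayed :: "int list \<Rightarrow> int set" where
  "stayed z = {x ! i | i. i < N \<and> x ! i = y ! i \<and> z ! i = x ! i}"

definition law :: "int \<times> nat \<Rightarrow> nat pmf" where
  "law = (\<lambda>(k, l). D_dist (real_of_int (k + int T - int t - int S - 1)) (real_of_int (k + 1)) l)"

definition weight :: "int list \<Rightarrow> real" where
  "weight z = P_tplus N T (S + 1) t y z * P_Sminus N T (S + 1) (t + 1) z x"

lemma len: "length y = N" "length x = N" and sorted: "sorted_wrt (<) y" "sorted_wrt (<) x"
  using x y by (auto simp: configs_def)

lemma x_less: "i < j \<Longrightarrow> j < N \<Longrightarrow> x ! i < x ! j"
  and y_less: "i < j \<Longrightarrow> j < N \<Longrightarrow> y ! i < y ! j"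
  using len sorted by (auto simp: sorted_wrt_iff_nth_less)

lemma x_inj: "i < N \<Longrightarrow> j < N \<Longrightarrow> x ! i = x ! j \<longleftrightarrow> i = j"
  using x_less by (metis less_irrefl nat_neq_iff)

lemma y_bounds:
  assumes "i < N"
  shows "0 \<le> y ! i" "int t + int S + 1 - int T \<le> y ! i"
    "y ! i \<le> int t + int N - 1" "y ! i \<le> int S + int N"
proof -
  have "y ! i \<in> slice N T (S + 1) t"
    using y assms nth_mem[of i y] unfolding configs_def by blast
  then show "0 \<le> y ! i" "int t + int S + 1 - int T \<le> y ! i"
    "y ! i \<le> int t + int N - 1" "y ! i \<le> int S + int N"
    by (auto simp: slice_def)
qed

lemma x_bounds:
  assumes "i < N"
  shows "0 \<le> x ! i" "int t + int S + 1 - int T \<le> x ! i"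
    "x ! i \<le> int t + int N" "x ! i \<le> int S + int N - 1"
proof -
  have "x ! i \<in> slice N T S (t + 1)"
    using x assms nth_mem[of i x] unfolding configs_def by blast
  then show "0 \<le> x ! i" "int t + int S + 1 - int T \<le> x ! i"
    "x ! i \<le> int t + int N" "x ! i \<le> int S + int N - 1"
    by (auto simp: slice_def)
qed

lemma finite_A: "finite A"
  by (simp add: stay_points_def)

lemma A_image: "A = (\<lambda>i. x ! i) ` {i. i < N \<and> x ! i = y ! i}"
  unfolding stay_points_def by blast

lemma in_A: "i < N \<Longrightarrow> x ! i = y ! i \<Longrightarrow> x ! i \<in> A"
  unfolding stay_points_def by blast

text \<open>The left end of a block is a particle position of \<open>x\<close>, and the lower bounds
  of its slice make the parameters of D admissible.\<close>

lemma block_params: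
  assumes "(k, l) \<in> blocks A"
  shows "k \<in> A" "real_of_int (k + int T - int t - int S - 1) \<ge> 0" "real_of_int (k + 1) > 0"
proof -
  show "k \<in> A"
    using assms by (auto simp: blocks_def)
  then obtain i where "i < N" "k = x ! i"
    by (auto simp: stay_points_def)
  then show "real_of_int (k + int T - int t - int S - 1) \<ge> 0" "real_of_int (k + 1) > 0"
    using x_bounds[of i] by linarith+
qed

section \<open>Block thresholds and interlaced configurations\<close>

lemma stays_block:
  assumes "(k, l) \<in> blocks A" "a \<in> {k..<k + int l}"
  shows "stays \<xi> a \<longleftrightarrow> a < k + int (\<xi> (k, l))"
  using assms blocks_unique[OF assms(1) _ assms(2)] unfolding stays_def by blast

text \<open>No block starts at \<open>a + 1\<close> while \<open>a\<close> lies in \<open>A\<close>,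
  so both points lie in one block and are compared with the same threshold.\<close>

lemma stays_downclosed:
  assumes "a \<in> A" "stays \<xi> (a + 1)"
  shows "stays \<xi> a"
proof -
  obtain k l where kl: "(k, l) \<in> blocks A" "a + 1 \<in> {k..<k + int l}" "a + 1 < k + int (\<xi> (k, l))"
    using assms(2) by (auto simp: stays_def)
  have "k \<noteq> a + 1" using kl(1) assms(1) by (auto simp: blocks_def)
  then show ?thesis using kl stays_block[OF kl(1), of a \<xi>] by auto
qed

lemma length_update [simp]: "length (update_config N y x \<xi>) = N"
  by (simp add: update_config_def)

lemma update_nth:
  assumes "i < N"
  shows "update_config N y x \<xi> ! i =
    (if x ! i - y ! i = 1 then x ! i else if x ! i - y ! i = -1 then y ! i
     else if stays \<xi> (x ! i) then x ! i else x ! i + 1)"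
  using assms diff[OF assms] by (auto simp: update_config_def stays_def)

text \<open>Neighbours can collide only if both are free (\<open>x ! i = y ! i\<close>) and
  adjacent, the lower one moves and the upper one stays; \<open>stays_downclosed\<close> rules this
  out.\<close>

lemma interlaced_update: "interlaced (update_config N y x \<xi>)"
proof -
  let ?z = "update_config N y x \<xi>"
  have *: "?z ! i - y ! i \<in> {0, 1} \<and> ?z ! i - x ! i \<in> {0, 1}" if "i < N" for i
    using diff[OF that] by (auto simp: update_nth[OF that])
  have "?z ! i < ?z ! Suc i" if i: "Suc i < N" for i
  proof (rule ccontr)
    assume neg: "\<not> ?thesis"
    have "x ! i < x ! Suc i" "y ! i < y ! Suc i"
      using x_less y_less i by auto
    with neg *[of i] *[of "Suc i"] i have eq: "?z ! i = x ! i + 1" "x ! i = y ! i"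
      "x ! Suc i = x ! i + 1" "y ! Suc i = x ! Suc i" "?z ! Suc i = x ! Suc i"
      by auto
    have "\<not> stays \<xi> (x ! i)" "stays \<xi> (x ! i + 1)"
      using eq update_nth[of i \<xi>] update_nth[of "Suc i" \<xi>] i by (auto split: if_splits)
    moreover have "x ! i \<in> A"
      using eq i by (intro in_A) auto
    ultimately show False using stays_downclosed by blast
  qed
  then have "sorted_wrt (<) ?z"
    by (subst sorted_wrt_iff_nth_Suc_transp) auto
  with * show ?thesis by (simp add: interlaced_def)
qed

lemma stayed_iff:
  assumes "i < N" "x ! i = y ! i"
  shows "x ! i \<in> stayed z \<longleftrightarrow> z ! i = x ! i"
  using assms x_inj unfolding stayed_def by blast

lemma stayed_update:
  assumes "a \<in> A"
  shows "a \<in> stayed (update_config N y x \<xi>) \<longleftrightarrow> stays \<xi> a"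
proof -
  obtain i where "i < N" "x ! i = y ! i" "a = x ! i"
    using assms by (auto simp: A_image)
  then show ?thesis
    using stayed_iff[of i "update_config N y x \<xi>"] update_nth[of i \<xi>] by simp
qed

text \<open>Where \<open>x ! i\<close> and \<open>y ! i\<close> differ, \<open>z ! i\<close> must be
  their maximum; a free particle has two options, told apart by \<open>stayed\<close>.\<close>

lemma interlaced_eqI:
  assumes "interlaced z" "interlaced z'" "\<And>a. a \<in> A \<Longrightarrow> a \<in> stayed z \<longleftrightarrow> a \<in> stayed z'"
  shows "z = z'"
proof (rule nth_equalityI)
  show "length z = length z'" using assms by (simp add: interlaced_def)
  fix i assume "i < length z"
  then have i: "i < N" using assms by (simp add: interlaced_def)
  have *: "z ! i - y ! i \<in> {0, 1} \<and> z ! i - x ! i \<in> {0, 1}"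
    "z' ! i - y ! i \<in> {0, 1} \<and> z' ! i - x ! i \<in> {0, 1}"
    using assms i by (auto simp: interlaced_def)
  show "z ! i = z' ! i"
  proof (cases "x ! i = y ! i")
    case True
    then have "x ! i \<in> A" using i by (rule in_A[rotated])
    from assms(3)[OF this] True i have "z ! i = x ! i \<longleftrightarrow> z' ! i = x ! i"
      using stayed_iff by blast
    then show ?thesis using * by auto
  qed (use * in auto)
qed

text \<open>If the particle at \<open>a\<close> moved, it would collide with the one resting at
  \<open>a + 1\<close>; here the strict ordering of \<open>z\<close> enters.\<close>

lemma stayed_downclosed:
  assumes z: "interlaced z" and "a \<in> A" "a + 1 \<in> A" "a + 1 \<in> stayed z"
  shows "a \<in> stayed z"
proof -
  obtain i where i: "i < N" "x ! i = y ! i" "a = x ! i"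
    using assms by (auto simp: stay_points_def)
  obtain j where j: "j < N" "x ! j = y ! j" "a + 1 = x ! j"
    using assms by (auto simp: stay_points_def)
  have "i < j"
    using i j x_less[of j i] by (metis less_add_one less_asym linorder_neqE_nat less_irrefl)
  then have "z ! i < z ! j"
    using z j by (auto simp: interlaced_def sorted_wrt_iff_nth_less)
  moreover have "z ! j = x ! j"
    using assms(4) j stayed_iff[of j z] by simp
  moreover have "z ! i - x ! i \<in> {0, 1}"
    using z i by (auto simp: interlaced_def)
  ultimately have "z ! i = x ! i" using i j by auto
  then show ?thesis using i stayed_iff[of i z] by simp
qed

lemma interlaced_thresholds:
  assumes z: "interlaced z"
  obtains \<xi> where "\<And>k l. (k, l) \<notin> blocks A \<Longrightarrow> \<xi> (k, l) = 0"
    and "\<And>k l. (k, l) \<in> blocks A \<Longrightarrow> \<xi> (k, l) \<le> l"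
    and "\<And>k l j. (k, l) \<in> blocks A \<Longrightarrow> j < l \<Longrightarrow> k + int j \<in> stayed z \<longleftrightarrow> j < \<xi> (k, l)"
proof -
  have "\<exists>n\<le>l. \<forall>j<l. k + int j \<in> stayed z \<longleftrightarrow> j < n" if kl: "(k, l) \<in> blocks A" for k l
  proof (rule threshold_of_downclosed)
    fix j assume j: "j + 1 < l" "k + int j + 1 \<in> stayed z"
    have "{k..<k + int l} \<subseteq> A" using kl by (auto simp: blocks_def)
    then have "k + int j \<in> A" "k + int j + 1 \<in> A"
      using j by auto
    then show "k + int j \<in> stayed z" using stayed_downclosed[OF z] j by blast
  qed
  then obtain \<zeta> where \<zeta>: "\<And>k l. (k, l) \<in> blocks A \<Longrightarrow>
      \<zeta> k l \<le> l \<and> (\<forall>j<l. k + int j \<in> stayed z \<longleftrightarrow> j < \<zeta> k l)"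
    by metis
  \<comment> \<open>The value 0 off the blocks is the default that \<open>Pi_pmf\<close> has in the
    algorithm.\<close>
  show thesis
    by (rule that[of "\<lambda>(k, l). if (k, l) \<in> blocks A then \<zeta> k l else 0"]) (use \<zeta> in auto)
qed

text \<open>The bound by \<open>l\<close> matters: a threshold beyond the block size gives the same
  configuration as \<open>l\<close> itself. Below it, the stays at the positions
  \<open>j < l\<close> determine the threshold.\<close>

lemma update_eq_iff:
  assumes z: "interlaced z"
    and \<xi>: "\<And>k l. (k, l) \<notin> blocks A \<Longrightarrow> \<xi> (k, l) = 0"
      "\<And>k l. (k, l) \<in> blocks A \<Longrightarrow> \<xi> (k, l) \<le> l"
      "\<And>k l j. (k, l) \<in> blocks A \<Longrightarrow> j < l \<Longrightarrow> k + int j \<in> stayed z \<longleftrightarrow> j < \<xi> (k, l)"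
    and \<zeta>: "\<And>k l. (k, l) \<notin> blocks A \<Longrightarrow> \<zeta> (k, l) = 0"
      "\<And>k l. (k, l) \<in> blocks A \<Longrightarrow> \<zeta> (k, l) \<le> l"
  shows "update_config N y x \<zeta> = z \<longleftrightarrow> \<zeta> = \<xi>"
proof
  assume eq: "update_config N y x \<zeta> = z"
  show "\<zeta> = \<xi>"
  proof (rule ext, clarify)
    fix k :: int and l :: nat
    show "\<zeta> (k, l) = \<xi> (k, l)"
    proof (cases "(k, l) \<in> blocks A")
      case True
      then have "{k..<k + int l} \<subseteq> A" by (auto simp: blocks_def)
      have "j < \<zeta> (k, l) \<longleftrightarrow> j < \<xi> (k, l)" if "j < l" for j
      proof -
        have a: "k + int j \<in> {k..<k + int l}" using that by auto
        then have "k + int j \<in> A" using \<open>{k..<k + int l} \<subseteq> A\<close> by blast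
        then have "k + int j \<in> stayed z \<longleftrightarrow> stays \<zeta> (k + int j)"
          using stayed_update eq by blast
        then show ?thesis using stays_block[OF True a, of \<zeta>] \<xi>(3)[OF True that] by simp
      qed
      then show ?thesis using \<xi>(2)[OF True] \<zeta>(2)[OF True]
        by (meson nat_neq_iff order_less_le_trans less_irrefl)
    qed (use \<xi> \<zeta> in simp)
  qed
next
  assume eq: "\<zeta> = \<xi>"
  show "update_config N y x \<zeta> = z"
  proof (rule interlaced_eqI[OF interlaced_update z])
    fix a assume a: "a \<in> A"
    obtain k l where kl: "(k, l) \<in> blocks A" "a \<in> {k..<k + int l}"
      using blocks_cover[OF finite_A a] by blast
    have "a \<in> stayed z \<longleftrightarrow> nat (a - k) < \<xi> (k, l)"
      using \<xi>(3)[OF kl(1), of "nat (a - k)"] kl(2) by auto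
    then show "a \<in> stayed (update_config N y x \<zeta>) \<longleftrightarrow> a \<in> stayed z"
      using a eq stays_block[OF kl, of \<xi>] kl(2) by (auto simp: stayed_update)
  qed
qed

section \<open>The law of one step\<close>

lemma algorithm_step_eq:
  "algorithm_step N T S t y x = map_pmf (update_config N y x) (Pi_pmf (blocks A) 0 law)"
  by (simp add: algorithm_step_def law_def)

lemma finite_blocks_A: "finite (blocks A)"
  by (rule finite_blocks[OF finite_A])

lemma set_Pi_lawD:
  assumes "\<zeta> \<in> set_pmf (Pi_pmf (blocks A) 0 law)"
  shows "(k, l) \<notin> blocks A \<Longrightarrow> \<zeta> (k, l) = 0"
    and "(k, l) \<in> blocks A \<Longrightarrow> \<zeta> (k, l) \<in> set_pmf (law (k, l))"
    and "(k, l) \<in> blocks A \<Longrightarrow> \<zeta> (k, l) \<le> l"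
proof -
  have *: "\<zeta> \<in> PiE_dflt (blocks A) 0 (set_pmf \<circ> law)"
    using assms by (simp add: set_Pi_pmf finite_blocks_A)
  show "(k, l) \<notin> blocks A \<Longrightarrow> \<zeta> (k, l) = 0"
    and **: "(k, l) \<in> blocks A \<Longrightarrow> \<zeta> (k, l) \<in> set_pmf (law (k, l))"
    using * by (auto simp: PiE_dflt_def)
  show "\<zeta> (k, l) \<le> l" if "(k, l) \<in> blocks A"
    using **[OF that] set_pmf_D_dist block_params[OF that] by (fastforce simp: law_def)
qed

text \<open>The factor of a free particle at \<open>a\<close> once the part common to staying and
  moving is split off. Along a block it runs through the factors of the Pochhammer symbols in
  D.\<close>

definition move_weight :: "int list \<Rightarrow> int \<Rightarrow> real" where
  "move_weight z a = (if a \<in> stayed z then real_of_int (a + int T - int t - int S - 1)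
     else real_of_int (a + 1))"

definition normalization :: real where
  "normalization = (\<Prod>(k, l)\<in>blocks A. \<Sum>j=0..l.
     D_weight (real_of_int (k + int T - int t - int S - 1)) (real_of_int (k + 1)) l j)"

lemma normalization_pos: "normalization > 0"
  unfolding normalization_def
  by (intro prod_pos) (use block_params in \<open>auto intro!: D_weight_sum_pos\<close>)

text \<open>Exactly one admissible sample produces \<open>z\<close>. By independence its mass is a
  product over blocks, and \<open>prod_threshold\<close> identifies each numerator.\<close>

lemma pmf_algorithm_step_interlaced:
  assumes z: "interlaced z"
  shows "pmf (algorithm_step N T S t y x) z = (\<Prod>a\<in>A. move_weight z a) / normalization"
proof -
  obtain \<xi> where \<xi>: "\<And>k l. (k, l) \<notin> blocks A \<Longrightarrow> \<xi> (k, l) = 0"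
      "\<And>k l. (k, l) \<in> blocks A \<Longrightarrow> \<xi> (k, l) \<le> l"
      "\<And>k l j. (k, l) \<in> blocks A \<Longrightarrow> j < l \<Longrightarrow> k + int j \<in> stayed z \<longleftrightarrow> j < \<xi> (k, l)"
    using interlaced_thresholds[OF z] by metis
  let ?M = "Pi_pmf (blocks A) 0 law"
  have iff: "update_config N y x \<zeta> = z \<longleftrightarrow> \<zeta> = \<xi>" if "\<zeta> \<in> set_pmf ?M" for \<zeta>
    using set_Pi_lawD[OF that] by (intro update_eq_iff[OF z \<xi>]) auto
  have "pmf (algorithm_step N T S t y x) z = measure ?M (update_config N y x -` {z})"
    by (simp add: algorithm_step_eq pmf_map)
  \<comment> \<open>The two events agree only on the support: values off the blocks or above a block
    size can give the same configuration.\<close>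
  also have "\<dots> = measure ?M {\<xi>}"
    by (rule measure_pmf.finite_measure_eq_AE) (auto simp: AE_measure_pmf_iff iff)
  also have "\<dots> = (\<Prod>p\<in>blocks A. pmf (law p) (\<xi> p))"
    using \<xi>(1) finite_blocks_A by (simp add: measure_pmf_single pmf_Pi)
  also have "\<dots> = (\<Prod>(k, l)\<in>blocks A.
      (\<Prod>j<l. move_weight z (k + int j)) /
      (\<Sum>j=0..l. D_weight (real_of_int (k + int T - int t - int S - 1)) (real_of_int (k + 1)) l j))"
  proof (intro prod.cong refl, clarify)
    fix k :: int and l :: nat assume kl: "(k, l) \<in> blocks A"
    have "(\<Prod>j<l. move_weight z (k + int j)) =
      (\<Prod>j<l. if j < \<xi> (k, l) then real_of_int (k + int T - int t - int S - 1) + real j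
        else real_of_int (k + 1) + real j)"
      by (intro prod.cong refl) (simp add: move_weight_def \<xi>(3)[OF kl])
    also have "\<dots> = D_weight (real_of_int (k + int T - int t - int S - 1))
        (real_of_int (k + 1)) l (\<xi> (k, l))"
      by (rule prod_threshold[OF \<xi>(2)[OF kl]])
    finally show "pmf (law (k, l)) (\<xi> (k, l)) = (\<Prod>j<l. move_weight z (k + int j)) /
      (\<Sum>j=0..l. D_weight (real_of_int (k + int T - int t - int S - 1)) (real_of_int (k + 1)) l j)"
      using block_params(2,3)[OF kl] \<xi>(2)[OF kl]
      by (simp add: law_def pmf_D_dist del: of_int_add of_int_diff)
  qed
  also have "\<dots> = (\<Prod>a\<in>A. move_weight z a) / normalization"
    by (simp add: prod_blocks[OF finite_A] normalization_def case_prod_unfold prod_dividef)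
  finally show ?thesis .
qed

lemma set_algorithm_step:
  assumes "z \<in> set_pmf (algorithm_step N T S t y x)"
  shows "interlaced z" "z \<in> configs N T (S + 1) (t + 1)"
proof -
  obtain \<zeta> where \<zeta>: "\<zeta> \<in> set_pmf (Pi_pmf (blocks A) 0 law)" "z = update_config N y x \<zeta>"
    using assms by (auto simp: algorithm_step_eq)
  show z: "interlaced z" by (simp add: \<zeta>(2) interlaced_update)
  have "z ! i \<in> slice N T (S + 1) (t + 1)" if i: "i < N" for i
  proof -
    have *: "z ! i - y ! i \<in> {0, 1}" "z ! i - x ! i \<in> {0, 1}"
      using z i by (auto simp: interlaced_def)
    note b = x_bounds[OF i] y_bounds[OF i]
    \<comment> \<open>The bound \<open>int t + int S + 2 - int T\<close> of the new slice is one
      above those known for \<open>x ! i\<close> and \<open>y ! i\<close>. All other bounds carry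
      over, so only this value has to be excluded.\<close>
    have "z ! i \<noteq> int t + int S + 1 - int T"
    proof
      assume e: "z ! i = int t + int S + 1 - int T"
      then have eq: "x ! i = y ! i" "z ! i = x ! i" using * b by auto
      \<comment> \<open>Then \<open>x ! i\<close> is the lowest admissible point, so it starts a block, whose first parameter is 0.\<close>
      have A: "x ! i \<in> A" using i eq(1) by (rule in_A)
      obtain k l where kl: "(k, l) \<in> blocks A" "x ! i \<in> {k..<k + int l}"
        using blocks_cover[OF finite_A A] by blast
      have k: "k = x ! i" using block_params(2)[OF kl(1)] kl(2) e eq by simp
      have "\<zeta> (k, l) \<in> set_pmf (D_dist 0 (real_of_int (k + 1)) l)"
        using set_Pi_lawD(2)[OF \<zeta>(1) kl(1)] k e eq by (simp add: law_def)
      then have "\<zeta> (k, l) = 0"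
        using set_pmf_D_dist_0[OF block_params(3)[OF kl(1)]] by blast
      then have "\<not> stays \<zeta> (x ! i)"
        using stays_block[OF kl, of \<zeta>] k by simp
      moreover have "stays \<zeta> (x ! i)"
        using eq \<zeta>(2) i by (auto simp: update_nth split: if_splits)
      ultimately show False by blast
    qed
    then show ?thesis using * b by (auto simp: slice_def)
  qed
  then show "z \<in> configs N T (S + 1) (t + 1)"
    using z by (auto simp: configs_def interlaced_def in_set_conv_nth)
qed

section \<open>Factorization of the matrix entries over particles\<close>

lemma weight_not_interlaced:
  assumes "z \<in> configs N T (S + 1) (t + 1)" "\<not> interlaced z"
  shows "weight z = 0"
proof -
  obtain i where "i < N" "\<not> (z ! i - y ! i \<in> {0, 1} \<and> z ! i - x ! i \<in> {0, 1})"
    using assms by (auto simp: interlaced_def configs_def)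
  then show ?thesis
    unfolding weight_def by (intro P_tplus_mult_P_Sminus_eq_0[of i]) auto
qed

text \<open>The part of \<open>weight z\<close> independent of \<open>z\<close>. A free particle
  contributes its factor through \<open>P_Sminus\<close> when staying and through
  \<open>P_tplus\<close> when moving; in the other two cases the move is forced.\<close>

definition prefactor :: real where
  "prefactor = vandermonde N x / vandermonde N y
     / (pochhammer (real T - real t) N * pochhammer (real (S + 1)) N)
     * (\<Prod>i<N. if x ! i = y ! i then real_of_int (int N + int S - x ! i)
          else if x ! i = y ! i + 1
          then real_of_int (int N + int S - y ! i) * real_of_int (int S + int N - x ! i)
          else real_of_int (y ! i + int T - int t - int S - 1) * real_of_int (y ! i))"

lemma prefactor_pos: "prefactor > 0"
proof -
  have "pochhammer (real T - real t) N > 0" "pochhammer (real (S + 1)) N > 0"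
    using t by (auto intro!: pochhammer_pos)
  moreover have "vandermonde N x > 0" "vandermonde N y > 0"
    using len sorted by (auto intro: vandermonde_pos)
  moreover have "(\<Prod>i<N. if x ! i = y ! i then real_of_int (int N + int S - x ! i)
          else if x ! i = y ! i + 1
          then real_of_int (int N + int S - y ! i) * real_of_int (int S + int N - x ! i)
          else real_of_int (y ! i + int T - int t - int S - 1) * real_of_int (y ! i)) > 0"
  proof (intro prod_pos ballI)
    fix i assume "i \<in> {..<N}"
    then have i: "i < N" by simp
    have "x ! i = y ! i \<or> x ! i = y ! i + 1 \<or> x ! i = y ! i - 1"
      using diff[OF i] by auto
    \<comment> \<open>If \<open>x ! i = y ! i - 1\<close>, the bounds on \<open>y ! i\<close> alone
      would permit a zero factor; strictness comes from those on \<open>x ! i\<close>.\<close>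
    then show "(if x ! i = y ! i then real_of_int (int N + int S - x ! i)
          else if x ! i = y ! i + 1
          then real_of_int (int N + int S - y ! i) * real_of_int (int S + int N - x ! i)
          else real_of_int (y ! i + int T - int t - int S - 1) * real_of_int (y ! i)) > 0"
      using x_bounds[OF i] y_bounds[OF i]
      by (auto simp del: of_int_add of_int_diff intro!: mult_pos_pos)
  qed
  ultimately show ?thesis
    unfolding prefactor_def by (intro mult_pos_pos divide_pos_pos)
qed

lemma weight_interlaced:
  assumes z: "interlaced z"
  shows "weight z = prefactor * (\<Prod>a\<in>A. move_weight z a)"
proof -
  have zd: "z ! i - y ! i \<in> {0, 1}" "z ! i - x ! i \<in> {0, 1}" if "i < N" for i
    using z that by (auto simp: interlaced_def)
  have vz: "vandermonde N z > 0"
    using z by (auto intro!: vandermonde_pos simp: interlaced_def)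
  let ?f = "\<lambda>i. if z ! i = y ! i + 1 then real_of_int (int N + int (S + 1) - y ! i - 1)
     else real_of_int (y ! i + int T - int t - int (S + 1))"
  let ?g = "\<lambda>i. if x ! i = z ! i - 1 then real_of_int (z ! i)
     else real_of_int (int (S + 1) + int N - 1 - z ! i)"
  let ?c = "\<lambda>i. if x ! i = y ! i then real_of_int (int N + int S - x ! i)
          else if x ! i = y ! i + 1
          then real_of_int (int N + int S - y ! i) * real_of_int (int S + int N - x ! i)
          else real_of_int (y ! i + int T - int t - int S - 1) * real_of_int (y ! i)"
  let ?m = "\<lambda>i. if x ! i = y ! i then move_weight z (x ! i) else 1"
  have "\<forall>i<N. z ! i - y ! i \<in> {0, 1}" using zd by blast
  then have 1: "P_tplus N T (S + 1) t y z =
      vandermonde N z * (\<Prod>i<N. ?f i) / (pochhammer (real T - real t) N * vandermonde N y)"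
    unfolding P_tplus_def
    by (subst prod_complementary_filters[symmetric, where Q = "\<lambda>i. z ! i = y ! i"])
       (use zd in \<open>auto simp: mult.assoc\<close>)
  have "\<forall>i<N. x ! i - z ! i \<in> {-1, 0}" using zd by fastforce
  then have 2: "P_Sminus N T (S + 1) (t + 1) z x =
      vandermonde N x * (\<Prod>i<N. ?g i) / (pochhammer (real (S + 1)) N * vandermonde N z)"
    unfolding P_Sminus_def
    by (subst prod_complementary_filters[symmetric, where Q = "\<lambda>i. x ! i = z ! i"])
       (use zd in \<open>auto simp: mult.assoc\<close>)
  \<comment> \<open>Here \<open>?c i\<close> does not see \<open>z\<close>, and \<open>?m i\<close>
    carries the choice of a free particle.\<close>
  have "?f i * ?g i = ?c i * ?m i" if i: "i < N" for i
  proof (cases "x ! i = y ! i")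
    case True
    then show ?thesis
      using zd[OF i] stayed_iff[OF i True, of z] by (auto simp: move_weight_def algebra_simps)
  next
    case False
    then have "x ! i = y ! i + 1 \<and> z ! i = y ! i + 1 \<or> x ! i = y ! i - 1 \<and> z ! i = y ! i"
      using zd[OF i] by auto
    then show ?thesis
      by (elim disjE conjE) (simp_all add: algebra_simps)
  qed
  then have 3: "(\<Prod>i<N. ?f i) * (\<Prod>i<N. ?g i) = (\<Prod>i<N. ?c i) * (\<Prod>i<N. ?m i)"
    by (simp only: prod.distrib[symmetric]) (intro prod.cong, auto)
  have "(\<Prod>i<N. ?m i) = (\<Prod>i\<in>{i. i < N \<and> x ! i = y ! i}. move_weight z (x ! i))"
    by (rule prod.mono_neutral_cong_right) auto
  also have "\<dots> = (\<Prod>a\<in>A. move_weight z a)"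
    unfolding A_image using x_inj by (subst prod.reindex) (blast intro: inj_onI, simp)
  finally have 4: "(\<Prod>i<N. ?m i) = (\<Prod>a\<in>A. move_weight z a)" .
  have "weight z = vandermonde N x / vandermonde N y
     / (pochhammer (real T - real t) N * pochhammer (real (S + 1)) N)
     * ((\<Prod>i<N. ?f i) * (\<Prod>i<N. ?g i))"
    unfolding weight_def 1 2 using vz by (simp add: field_simps)
  then show ?thesis
    unfolding 3 4 prefactor_def by (simp add: mult.assoc)
qed

lemma pmf_algorithm_step:
  assumes "z \<in> configs N T (S + 1) (t + 1)"
  shows "pmf (algorithm_step N T S t y x) z = weight z / (prefactor * normalization)"
proof (cases "interlaced z")
  case True
  then show ?thesis
    using prefactor_pos by (simp add: pmf_algorithm_step_interlaced weight_interlaced)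
next
  case False
  then show ?thesis
    using set_algorithm_step(1)[of z] weight_not_interlaced[OF assms]
    by (auto simp: set_pmf_iff)
qed

text \<open>
  The value of the normalizing sum follows from both sides of \<open>pmf_algorithm_step\<close> being
  summed over all configurations, the left one having total mass 1.
\<close>

lemma P_tplus_Sminus_eq: "P_tplus_Sminus N T (S + 1) t y x = prefactor * normalization"
proof -
  have "1 = (\<Sum>z\<in>configs N T (S + 1) (t + 1). pmf (algorithm_step N T S t y x) z)"
    by (rule sum_pmf_eq_1[symmetric]) (use finite_configs set_algorithm_step(2) in auto)
  also have "\<dots> = P_tplus_Sminus N T (S + 1) t y x / (prefactor * normalization)"
    by (simp add: pmf_algorithm_step sum_divide_distrib P_tplus_Sminus_def weight_def)
  finally show ?thesis
    using prefactor_pos normalization_pos by (simp add: field_simps)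
qed

lemma P_tplus_Sminus_pos: "P_tplus_Sminus N T (S + 1) t y x > 0"
  unfolding P_tplus_Sminus_eq by (intro mult_pos_pos prefactor_pos normalization_pos)

lemma pmf_algorithm_step_eq_ratio:
  assumes "z \<in> configs N T (S + 1) (t + 1)"
  shows "pmf (algorithm_step N T S t y x) z =
    P_tplus N T (S + 1) t y z * P_Sminus N T (S + 1) (t + 1) z x
      / P_tplus_Sminus N T (S + 1) t y x"
  unfolding pmf_algorithm_step[OF assms] P_tplus_Sminus_eq weight_def ..

end

section \<open>Path families\<close>

text \<open>Unit jumps propagate bounds forward from the start (\<open>up\<close>) and backward from
  the end (\<open>down\<close>); together they give the four bounds of the slice.\<close>

lemma path_families_configs:
  assumes X: "X \<in> path_families N T S" and t: "t \<le> T"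
  shows "X ! t \<in> configs N T S t"
proof -
  have jump: "X ! (s + 1) ! i - X ! s ! i \<in> {0, 1}" if "s < T" "i < N" for s i
    using X that by (auto simp: path_families_def)
  have up: "int i \<le> X ! s ! i \<and> X ! s ! i \<le> int i + int s" if i: "i < N" and "s \<le> T" for i s
    using that(2)
  proof (induction s)
    case 0
    then show ?case using X i by (auto simp: path_families_def)
  next
    case (Suc s)
    then show ?case using jump[of s i] i by auto
  qed
  have down: "X ! s ! i \<le> int S + int i \<and> int S + int i \<le> X ! s ! i + int T - int s"
    if i: "i < N" and "s \<le> T" for i s
    using that(2)
  proof (induction s rule: inc_induct)
    case base
    then show ?case using X i by (auto simp: path_families_def)
  next
    case (step s)
    then show ?case using jump[of s i] i by auto
  qed
  have "X ! t ! i \<in> slice N T S t" if "i < N" for i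
    using up[OF that t] down[OF that t] that by (auto simp: slice_def)
  then show ?thesis
    using X t by (auto simp: configs_def path_families_def in_set_conv_nth)
qed

text \<open>At time \<open>T\<close> the slice has at most \<open>N\<close> points, so
  \<open>N\<close> increasing entries fill it. The endpoints of the new paths thus come from slice
  membership alone.\<close>

lemma configs_T_nth:
  assumes z: "z \<in> configs N T S T" and i: "i < N"
  shows "z ! i = int S + int i"
proof -
  have mem: "z ! j \<in> slice N T S T" if "j < N" for j
    using z that by (auto simp: configs_def)
  have increasing: "z ! j < z ! Suc j" if "Suc j < N" for j
    using z that by (auto simp: configs_def sorted_wrt_iff_nth_less)
  have lower: "int S + int j \<le> z ! j" if "j < N" for j
    using that
  proof (induction j)
    case 0
    then show ?case using mem[of 0] by (auto simp: slice_def)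
  next
    case (Suc j)
    then show ?case using increasing[of j] by auto
  qed
  have "z ! j \<le> int S + int j" if "j \<le> N - 1" for j
    using that
  proof (induction j rule: inc_induct)
    case base
    then show ?case using mem[of "N - 1"] i by (auto simp: slice_def)
  next
    case (step j)
    then have "Suc j < N" by linarith
    with step show ?case using increasing[of j] by auto
  qed
  with lower[OF i] i show ?thesis by (simp add: order_antisym)
qed

section \<open>Runs of the algorithm and their joint law\<close>

definition partial_run :: "nat \<Rightarrow> nat \<Rightarrow> nat \<Rightarrow> int list list \<Rightarrow> nat \<Rightarrow> int list list \<Rightarrow> bool" where
  "partial_run N T S X t Y \<longleftrightarrow> length Y = t + 1 \<and> Y ! 0 = map int [0..<N] \<and>
     (\<forall>s\<le>t. Y ! s \<in> configs N T (S + 1) s) \<and>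
     (\<forall>i<N. Y ! t ! i - X ! t ! i \<in> {0, 1}) \<and>
     (\<forall>s<t. \<forall>i<N. Y ! (s + 1) ! i - Y ! s ! i \<in> {0, 1})"

lemma update_stepI:
  assumes "S < T" "X \<in> path_families N T S" "t < T" "y \<in> configs N T (S + 1) t"
    and "\<And>i. i < N \<Longrightarrow> X ! (t + 1) ! i - y ! i \<in> {-1, 0, 1}"
  shows "update_step N T S t y (X ! (t + 1))"
  using assms path_families_configs[of X N T S "t + 1"] by unfold_locales auto

text \<open>Both Y(t) and X(t + 1) exceed X(t) by 0 or 1 in each entry, so they differ by at most 1.
  This is why \<open>partial_run\<close> compares with \<open>X\<close> at the last time.\<close>

lemma update_step_partial_run:
  assumes "S < T" "X \<in> path_families N T S" "t < T" "partial_run N T S X t Y"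
  shows "update_step N T S t (Y ! t) (X ! (t + 1))"
proof (rule update_stepI)
  show "Y ! t \<in> configs N T (S + 1) t"
    using assms by (auto simp: partial_run_def)
  fix i assume "i < N"
  then have "Y ! t ! i - X ! t ! i \<in> {0, 1}" "X ! (t + 1) ! i - X ! t ! i \<in> {0, 1}"
    using assms by (auto simp: partial_run_def path_families_def)
  then show "X ! (t + 1) ! i - Y ! t ! i \<in> {-1, 0, 1}" by auto
qed (use assms in auto)

lemma partial_run_algorithm_upto:
  assumes "S < T" "X \<in> path_families N T S" "t \<le> T"
    and "Y \<in> set_pmf (algorithm_upto N T S X t)"
  shows "partial_run N T S X t Y"
  using assms(3,4)
proof (induction t arbitrary: Y)
  case 0
  \<comment> \<open>By \<open>S < T\<close> the slice of level \<open>S + 1\<close> at time 0 starts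
    at 0.\<close>
  have "map int [0..<N] \<in> configs N T (S + 1) 0"
    using assms(1) by (auto simp: configs_def slice_def sorted_wrt_iff_nth_less)
  then show ?case
    using 0 assms(2) by (auto simp: partial_run_def path_families_def)
next
  case (Suc t)
  obtain Y0 z where Y0: "Y0 \<in> set_pmf (algorithm_upto N T S X t)" "Y = Y0 @ [z]"
    and z: "z \<in> set_pmf (algorithm_step N T S t (Y0 ! t) (X ! (t + 1)))"
    using Suc.prems by auto
  have run: "partial_run N T S X t Y0"
    using Suc.IH Suc.prems Y0 by simp
  interpret update_step N T S t "Y0 ! t" "X ! (t + 1)"
    by (rule update_step_partial_run[OF assms(1,2) _ run]) (use Suc.prems in simp)
  have z': "\<forall>i<N. z ! i - Y0 ! t ! i \<in> {0, 1} \<and> z ! i - X ! (t + 1) ! i \<in> {0, 1}"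
    using set_algorithm_step(1)[OF z] unfolding interlaced_def by blast
  have len: "length Y0 = Suc t" using run by (simp add: partial_run_def)
  then have old: "Y ! s = Y0 ! s" if "s \<le> t" for s
    using that by (simp add: Y0(2) nth_append)
  have new: "Y ! Suc t = z"
    using len by (simp add: Y0(2) nth_append)
  show ?case
    unfolding partial_run_def
  proof (intro conjI allI impI)
    show "length Y = Suc t + 1" using len Y0(2) by simp
    show "Y ! 0 = map int [0..<N]" using run old[of 0] by (simp add: partial_run_def)
    show "Y ! s \<in> configs N T (S + 1) s" if "s \<le> Suc t" for s
      using that run set_algorithm_step(2)[OF z] old new by (cases "s = Suc t") (auto simp: partial_run_def)
    show "Y ! Suc t ! i - X ! Suc t ! i \<in> {0, 1}" if "i < N" for i
      using z' that new by simp
    show "Y ! (s + 1) ! i - Y ! s ! i \<in> {0, 1}" if "s < Suc t" "i < N" for s i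
      using that run z' old new by (cases "s = t") (auto simp: partial_run_def)
  qed
qed

lemma partial_run_path_families:
  assumes "partial_run N T S X T Y"
  shows "Y \<in> path_families N T (S + 1)"
proof -
  have "Y ! T \<in> configs N T (S + 1) T"
    using assms by (simp add: partial_run_def)
  then have "\<forall>i<N. Y ! T ! i = int (S + 1) + int i"
    using configs_T_nth by blast
  then show ?thesis
    using assms by (simp add: partial_run_def path_families_def configs_def)
qed

text \<open>The history can be read off the extended list, so only the history \<open>Y\<close>
  contributes to the bind.\<close>

lemma pmf_algorithm_upto_Suc:
  "pmf (algorithm_upto N T S X (Suc t)) (Y @ [z]) =
    pmf (algorithm_upto N T S X t) Y * pmf (algorithm_step N T S t (Y ! t) (X ! (t + 1))) z"
proof -
  have *: "pmf (map_pmf (\<lambda>z. Y0 @ [z]) M) (Y @ [z]) = indicator {Y} Y0 * pmf M z" for Y0 M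
  proof (cases "Y0 = Y")
    case True
    then show ?thesis
      using pmf_map_inj'[of "\<lambda>z. Y @ [z]" M z] by (simp add: inj_def)
  next
    case False
    then show ?thesis by (auto simp: pmf_eq_0_set_pmf)
  qed
  have "pmf (algorithm_upto N T S X (Suc t)) (Y @ [z]) =
     measure_pmf.expectation (algorithm_upto N T S X t)
       (\<lambda>Y0. indicator {Y} Y0 * pmf (algorithm_step N T S t (Y0 ! t) (X ! (t + 1))) z)"
    by (simp add: pmf_bind *)
  also have "\<dots> = measure_pmf.expectation (algorithm_upto N T S X t)
       (\<lambda>Y0. indicator {Y} Y0 * pmf (algorithm_step N T S t (Y ! t) (X ! (t + 1))) z)"
    by (intro Bochner_Integration.integral_cong) (auto simp: indicator_def)
  finally show ?thesis by (simp add: measure_pmf_single)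
qed

text \<open>In a nonzero summand \<open>x ! i - y ! i\<close> is the sum of a jump in {0, 1} and one
  in {-1, 0}.\<close>

lemma P_tplus_Sminus_eq_0:
  assumes "i < N" "x ! i - y ! i \<notin> {-1, 0, 1}"
  shows "P_tplus_Sminus N T S t y x = 0"
  unfolding P_tplus_Sminus_def
proof (rule sum.neutral, rule ballI)
  fix z
  show "P_tplus N T S t y z * P_Sminus N T S (t + 1) z x = 0"
    using assms by (intro P_tplus_mult_P_Sminus_eq_0[of i]) auto
qed

lemma pmf_algorithm_upto_take:
  assumes S: "S < T" and X: "X \<in> path_families N T S" and Y: "Y \<in> path_families N T (S + 1)"
    and "t \<le> T"
  shows "pmf (algorithm_upto N T S X t) (take (t + 1) Y) =
    (\<Prod>s<t. P_tplus N T (S + 1) s (Y ! s) (Y ! (s + 1))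
            * P_Sminus N T (S + 1) (s + 1) (Y ! (s + 1)) (X ! (s + 1))
            / P_tplus_Sminus N T (S + 1) s (Y ! s) (X ! (s + 1)))"
  using assms(4)
proof (induction t)
  case 0
  have "length Y = T + 1" "length (Y ! 0) = N" "\<forall>i<N. Y ! 0 ! i = int i"
    using Y by (auto simp: path_families_def)
  then have "take (0 + 1) Y = [map int [0..<N]]"
    by (cases Y) (auto intro!: nth_equalityI)
  then show ?case by simp
next
  case (Suc t)
  have lenY: "length Y = T + 1" using Y by (simp add: path_families_def)
  then have take: "take (Suc t + 1) Y = take (t + 1) Y @ [Y ! (t + 1)]"
    using Suc.prems take_Suc_conv_app_nth[of "t + 1" Y] by simp
  have conf: "Y ! t \<in> configs N T (S + 1) t" "Y ! (t + 1) \<in> configs N T (S + 1) (t + 1)"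
    using path_families_configs[OF Y] Suc.prems by auto
  let ?r = "P_tplus N T (S + 1) t (Y ! t) (Y ! (t + 1))
            * P_Sminus N T (S + 1) (t + 1) (Y ! (t + 1)) (X ! (t + 1))
            / P_tplus_Sminus N T (S + 1) t (Y ! t) (X ! (t + 1))"
  have nth: "take (t + 1) Y ! t = Y ! t" by simp
  \<comment> \<open>The step is compared after multiplication by the mass of the past: the ratio
    formula is available only for differences in {-1, 0, 1}, and otherwise the past itself has mass
    0.\<close>
  have "pmf (algorithm_upto N T S X t) (take (t + 1) Y)
        * pmf (algorithm_step N T S t (Y ! t) (X ! (t + 1))) (Y ! (t + 1)) =
      pmf (algorithm_upto N T S X t) (take (t + 1) Y) * ?r"
  proof (cases "\<forall>i<N. X ! (t + 1) ! i - Y ! t ! i \<in> {-1, 0, 1}")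
    case True
    interpret update_step N T S t "Y ! t" "X ! (t + 1)"
      by (rule update_stepI[OF S X _ conf(1)]) (use True Suc.prems in auto)
    show ?thesis by (simp only: pmf_algorithm_step_eq_ratio[OF conf(2)])
  next
    case False
    have "take (t + 1) Y \<notin> set_pmf (algorithm_upto N T S X t)"
    proof
      assume "take (t + 1) Y \<in> set_pmf (algorithm_upto N T S X t)"
      then have "partial_run N T S X t (take (t + 1) Y)"
        using partial_run_algorithm_upto[OF S X] Suc.prems by simp
      then interpret update_step N T S t "take (t + 1) Y ! t" "X ! (t + 1)"
        by (rule update_step_partial_run[OF S X, rotated]) (use Suc.prems in simp)
      show False using diff False unfolding nth by blast
    qed
    then show ?thesis by (simp add: set_pmf_iff)
  qed
  then show ?case
    unfolding take pmf_algorithm_upto_Suc nth using Suc by simp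
qed

theorem theorem4p1:
  fixes N T S :: nat and X :: "int list list"
  assumes "N \<ge> 1" and "T \<ge> 1" and "S \<le> T - 1"
    and "X \<in> path_families N T S"
  shows "(AE Y in measure_pmf (algorithm_S_up N T S X). Y \<in> path_families N T (S + 1)) \<and>
    (\<forall>Y'\<in>path_families N T (S + 1).
       measure_pmf.prob (algorithm_S_up N T S X) {Y. Y = Y'} = P_S_up N T S X Y')"
proof (intro conjI ballI)
  have S: "S < T" using assms by simp
  note X = assms(4)
  show "AE Y in measure_pmf (algorithm_S_up N T S X). Y \<in> path_families N T (S + 1)"
    using partial_run_algorithm_upto[OF S X] partial_run_path_families
    unfolding AE_measure_pmf_iff algorithm_S_up_def by blast
  fix Y' assume Y': "Y' \<in> path_families N T (S + 1)"
  let ?p = "\<lambda>t. P_tplus_Sminus N T (S + 1) t (Y' ! t) (X ! (t + 1))"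
  let ?q = "\<Prod>t<T. P_tplus N T (S + 1) t (Y' ! t) (Y' ! (t + 1))
                * P_Sminus N T (S + 1) (t + 1) (Y' ! (t + 1)) (X ! (t + 1)) / ?p t"
  have "length Y' = T + 1" using Y' by (simp add: path_families_def)
  then have "measure_pmf.prob (algorithm_S_up N T S X) {Y. Y = Y'} = ?q"
    using pmf_algorithm_upto_take[OF S X Y' order_refl]
    by (simp add: algorithm_S_up_def measure_pmf_single)
  also have "?q = P_S_up N T S X Y'"
  proof (cases "\<exists>t<T. ?p t = 0")
    case True
    then obtain t where t: "t < T" "?p t = 0" by blast
    \<comment> \<open>Division by zero yields 0, which matches the zero case of
      \<open>P_S_up\<close>.\<close>
    then have "?q = 0" "(\<Prod>t<T. ?p t) = 0" by (auto intro!: prod_zero bexI[of _ t])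
    then show ?thesis by (simp only: P_S_up_def if_False less_irrefl)
  next
    case False
    \<comment> \<open>A nonzero denominator forces admissible differences, and for these it is
      positive.\<close>
    have "?p t > 0" if t: "t < T" for t
    proof -
      have "X ! (t + 1) ! i - Y' ! t ! i \<in> {-1, 0, 1}" if "i < N" for i
        using P_tplus_Sminus_eq_0[OF that] False t by blast
      then interpret update_step N T S t "Y' ! t" "X ! (t + 1)"
        using path_families_configs[OF Y'] t by (intro update_stepI[OF S X]) auto
      show ?thesis by (rule P_tplus_Sminus_pos)
    qed
    then have "(\<Prod>t<T. ?p t) > 0" by (intro prod_pos) auto
    then show ?thesis by (simp only: P_S_up_def if_True)
  qed
  finally show "measure_pmf.prob (algorithm_S_up N T S X) {Y. Y = Y'} = P_S_up N T S X Y'" .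
qed

end
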